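(* Any (probabilistic bounded error or deterministic) symbolic algorithm that computes the strongly connected components (SCCs) of directed graphs with $n$ vertices needs $\Omega(n)$ symbolic one-step operations. Moreover, writing $SCCs(G)$ for the set of SCCs of the input graph $G$ and $D$ for its diameter, any such algorithm needs $\Omega(|SCCs(G)|\cdot D)$ symbolic one-step operations.
   Context: Symbolic model: the input is a finite directed graph $G=(V,E)$ (self-loops allowed), $n=|V|$. The algorithm knows $V$, but it can access $E$ only through the one-step operations $\mathrm{Pre}(S)=\{v\in V\mid \exists s\in S:(v,s)\in E\}$ and $\mathrm{Post}(S)=\{v\in V\mid \exists s\in S:(s,v)\in E\}$ applied to (adaptively chosen) sets $S\subseteq V$. All other computation, in particular basic set operations such as $\cup,\cap,\setminus,\subseteq,=$ on vertex sets, is unrestricted and not counted in lower bounds; any number of sets may be stored. A probabilistic bounded error algorithm may use random bits and must be correct with probability at least $2/3$ on every input. Convention for lower bounds: "needs $\Omega(g)$ one-step operations", for a parameter $g$ of the input, means: there is an absolute constant $c>0$ such that every (deterministic or probabilistic bounded error) symbolic algorithm solving the problem on all inputs performs, on inputs with arbitrarily large $g$, at least $c\cdot g$ one-step operations (worst case over its random choices). The diameter $D$ of $G$ is the largest finite distance: the maximum of $d(u,v)$ over all pairs $u,v$ such that $u$ can reach $v$, where $d(u,v)$ is the smallest number of edges on a path from $u$ to $v$. A single vertex not on any cycle through other vertices forms a (trivial) SCC. *)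

theory Defs
  imports
    "HOL-Probability.Probability"
    "Graph_Theory.Pair_Digraph"
    "Graph_Theory.Digraph_Component"
begin

section \<open>Input graphs\<close>

text \<open>
  An input is a \<^typ>\<open>nat pair_pre_digraph\<close> satisfying \<^const>\<open>pair_fin_digraph\<close>: a finite vertex set
  \<^const>\<open>pverts\<close> of naturals (vertex names) and an edge relation \<^const>\<open>parcs\<close>, self-loops allowed.
\<close>

type_synonym input = "nat pair_pre_digraph"

definition Pre :: "input \<Rightarrow> nat set \<Rightarrow> nat set" where
  "Pre G S = {v \<in> pverts G. \<exists>s\<in>S. (v, s) \<in> parcs G}"

definition Post :: "input \<Rightarrow> nat set \<Rightarrow> nat set" where
  "Post G S = {v \<in> pverts G. \<exists>s\<in>S. (s, v) \<in> parcs G}"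

definition SCCs :: "input \<Rightarrow> nat set set" where
  "SCCs G = pre_digraph.sccs_verts (with_proj G)"

text \<open>Only meaningful if \<open>v\<close> is reachable from \<open>u\<close>.\<close>

definition distance :: "input \<Rightarrow> nat \<Rightarrow> nat \<Rightarrow> nat" where
  "distance G u v = (LEAST k. \<exists>p. pre_digraph.awalk (with_proj G) u p v \<and> length p = k)"

text \<open>The pairs include \<open>u = v\<close> (at distance 0), so the set is nonempty unless \<open>G\<close> has no vertex.\<close>

definition graph_diameter :: "input \<Rightarrow> nat" where
  "graph_diameter G = Max {distance G u v | u v. u \<rightarrow>\<^sup>*\<^bsub>with_proj G\<^esub> v}"


section \<open>Symbolic algorithms\<close>

datatype 'r action = PreOp "nat set" | PostOp "nat set" | Output 'r

text \<open>
  On a fixed vertex set (and fixed random bits) an algorithm is a strategy: its next action is an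
  arbitrary function of the answers to all one-step operations performed so far.  This leaves all
  other computation and the storage unrestricted and uncounted; the edges are seen only through the
  answers.  Nothing forces a strategy to halt.
\<close>

type_synonym 'r strategy = "nat set list \<Rightarrow> 'r action"

primrec answers :: "input \<Rightarrow> 'r strategy \<Rightarrow> nat \<Rightarrow> nat set list" where
  "answers G s 0 = []"
| "answers G s (Suc k) =
    (case s (answers G s k) of
       PreOp S \<Rightarrow> answers G s k @ [Pre G S]
     | PostOp S \<Rightarrow> answers G s k @ [Post G S]
     | Output r \<Rightarrow> answers G s k)"

definition outputs :: "input \<Rightarrow> 'r strategy \<Rightarrow> 'r \<Rightarrow> bool" where
  "outputs G s r \<longleftrightarrow> (\<exists>k. s (answers G s k) = Output r)"

text \<open>The number of one-step operations performed; infinite if the run does not halt.\<close>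

definition num_ops :: "input \<Rightarrow> 'r strategy \<Rightarrow> enat" where
  "num_ops G s = (SUP k. enat (length (answers G s k)))"

text \<open>
  A deterministic algorithm is given the vertex set; a probabilistic one is given in addition an
  infinite sequence of independent fair coin tosses.
\<close>

type_synonym 'r det_alg = "nat set \<Rightarrow> 'r strategy"
type_synonym 'r prob_alg = "nat set \<Rightarrow> (nat \<Rightarrow> bool) \<Rightarrow> 'r strategy"

definition coin_tosses :: "(nat \<Rightarrow> bool) measure" where
  "coin_tosses = PiM UNIV (\<lambda>_. measure_pmf (bernoulli_pmf (1/2)))"

definition det_solves :: "(input \<Rightarrow> 'r) \<Rightarrow> 'r det_alg \<Rightarrow> bool" where
  "det_solves f A \<longleftrightarrow> (\<forall>G. pair_fin_digraph G \<longrightarrow> outputs G (A (pverts G)) (f G))"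

text \<open>
  The event is measurable whenever each halting run reads only finitely many coin tosses.  In
  general, the bound on \<^const>\<open>measure\<close> entails measurability, since non-measurable sets get measure 0.
\<close>

definition prob_solves :: "(input \<Rightarrow> 'r) \<Rightarrow> 'r prob_alg \<Rightarrow> bool" where
  "prob_solves f A \<longleftrightarrow> (\<forall>G. pair_fin_digraph G \<longrightarrow>
     measure coin_tosses {b. outputs G (A (pverts G) b) (f G)} \<ge> 2/3)"

definition det_cost :: "'r det_alg \<Rightarrow> input \<Rightarrow> enat" where
  "det_cost A G = num_ops G (A (pverts G))"

definition prob_cost :: "'r prob_alg \<Rightarrow> input \<Rightarrow> enat" where
  "prob_cost A G = (SUP b. num_ops G (A (pverts G) b))"


section \<open>Lower bounds\<close>

text \<open>
  Solving \<open>f\<close> needs \<open>\<Omega>(g)\<close> one-step operations: one constant \<open>c\<close> serves all algorithms, and each of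
  them performs at least \<open>c * g\<close> operations on inputs with arbitrarily large \<open>g\<close>.
\<close>

definition needs_Omega_ops :: "(input \<Rightarrow> 'r) \<Rightarrow> (input \<Rightarrow> nat) \<Rightarrow> bool" where
  "needs_Omega_ops f g \<longleftrightarrow> (\<exists>c::real. c > 0 \<and>
     (\<forall>A. det_solves f A \<longrightarrow> (\<forall>N. \<exists>G. pair_fin_digraph G \<and> g G \<ge> N \<and>
        ereal_of_enat (det_cost A G) \<ge> ereal (c * real (g G)))) \<and>
     (\<forall>A. prob_solves f A \<longrightarrow> (\<forall>N. \<exists>G. pair_fin_digraph G \<and> g G \<ge> N \<and>
        ereal_of_enat (prob_cost A G) \<ge> ereal (c * real (g G)))))"

end

theory Submission
  imports Defs
begin

text \<open>
  Vertices are \<open>0, \<dots>, n\<close>; all forward arcs are present, and from the backward path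
  \<open>n \<rightarrow> n - 1 \<rightarrow> \<dots> \<rightarrow> 0\<close> at most one arc \<open>m + 1 \<rightarrow> m\<close> is missing.  Because of the forward arcs
  and self-loops, the answer to a one-step operation depends on only one backward arc: the one
  entering the maximum of \<open>S\<close> (for \<^const>\<open>Pre\<close>) or leaving its minimum (for \<^const>\<open>Post\<close>).
  So \<open>T\<close> operations inspect at most \<open>T\<close> backward arcs.  With the full backward path the graph is
  strongly connected with diameter \<open>n\<close>, and it stops being so when any one arc is missing.  For each
  of the \<open>n\<close> backward arcs, the random bits for which the algorithm is correct both with and
  without that arc have probability at least \<open>1/3\<close>, and for those bits the arc must be inspected in
  the run on the full graph.  Hence some run performs at least \<open>n/3\<close> operations.
\<close>

text \<open>For \<open>m \<ge> n\<close> no backward arc is missing.\<close>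

definition back_path :: "nat \<Rightarrow> nat \<Rightarrow> input" where
  "back_path n m = \<lparr>pverts = {..n},
     parcs = {(i, j). i \<le> n \<and> j \<le> n \<and> (i \<le> j \<or> i = Suc j \<and> j \<noteq> m)}\<rparr>"

lemma pverts_back_path [simp]: "pverts (back_path n m) = {..n}"
  by (simp add: back_path_def)

lemma parcs_back_path_iff:
  "(i, j) \<in> parcs (back_path n m) \<longleftrightarrow> i \<le> n \<and> j \<le> n \<and> (i \<le> j \<or> i = Suc j \<and> j \<noteq> m)"
  by (simp add: back_path_def)

lemma pair_fin_digraph_back_path: "pair_fin_digraph (back_path n m)"
proof
  show "finite (parcs (back_path n m))"
    by (rule finite_subset[of _ "{..n} \<times> {..n}"]) (auto simp: back_path_def)
qed (auto simp: back_path_def)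


section \<open>Components and diameter\<close>

lemma awalk_back_path_descending:
  assumes "v + k \<le> n"
  shows "\<exists>p. pre_digraph.awalk (with_proj (back_path n n)) (v + k) p v \<and> length p = k"
proof -
  interpret pair_fin_digraph "back_path n n" by (rule pair_fin_digraph_back_path)
  from assms show ?thesis
  proof (induction k)
    case 0
    then show ?case by (intro exI[of _ "[]"]) (simp add: awalk_Nil_iff)
  next
    case (Suc k)
    then obtain p where "awalk (v + k) p v" "length p = k" by auto
    with Suc.prems have "awalk (v + Suc k) ((v + Suc k, v + k) # p) v"
      by (auto simp: awalk_Cons_iff parcs_back_path_iff)
    with \<open>length p = k\<close> show ?case by (intro exI conjI) auto
  qed
qed

lemma awalk_back_path_short:
  assumes "u \<le> n" "v \<le> n" "0 < n"
  shows "\<exists>p. pre_digraph.awalk (with_proj (back_path n n)) u p v \<and> length p \<le> n"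
proof (cases "u \<le> v")
  case True
  interpret pair_fin_digraph "back_path n n" by (rule pair_fin_digraph_back_path)
  \<comment> \<open>One forward arc suffices, or a self-loop when \<open>u = v\<close>; its length 1
    is where \<open>0 < n\<close> enters.\<close>
  from True assms have "awalk u [(u, v)] v"
    by (auto simp: awalk_Cons_iff awalk_Nil_iff parcs_back_path_iff)
  with \<open>0 < n\<close> show ?thesis by (intro exI[of _ "[(u, v)]"]) auto
next
  case False
  with awalk_back_path_descending[of v "u - v" n] assms show ?thesis by fastforce
qed

text \<open>An arc lowers the vertex number by at most one, so the forward arcs offer no shortcut
  from \<open>n\<close> down to \<open>0\<close>.\<close>

lemma awalk_back_path_length_ge:
  assumes "pre_digraph.awalk (with_proj (back_path n m)) u p v"
  shows "u \<le> v + length p"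
proof -
  interpret pair_fin_digraph "back_path n m" by (rule pair_fin_digraph_back_path)
  from assms show ?thesis
    by (induction p arbitrary: u) (fastforce simp: awalk_Nil_iff awalk_Cons_iff parcs_back_path_iff)+
qed

lemma reachable_back_path_iff:
  assumes "0 < n"
  shows "u \<rightarrow>\<^sup>*\<^bsub>with_proj (back_path n n)\<^esub> v \<longleftrightarrow> u \<le> n \<and> v \<le> n"
proof -
  interpret pair_fin_digraph "back_path n n" by (rule pair_fin_digraph_back_path)
  show ?thesis
    using awalk_back_path_short[OF _ _ assms] reachable_in_verts
    unfolding reachable_awalk pverts_back_path atMost_iff by meson
qed

lemma SCCs_back_path:
  assumes "0 < n"
  shows "SCCs (back_path n n) = {{..n}}"
proof -
  \<comment> \<open>The left side is the body of \<open>sccs_verts\<close> with mutual reachability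
    already replaced by membership in \<open>{..n}\<close>.\<close>
  have "S \<noteq> {} \<and> (\<forall>u\<in>S. \<forall>v\<in>S. u \<le> n \<and> v \<le> n) \<and>
      (\<forall>u\<in>S. \<forall>v. v \<notin> S \<longrightarrow> \<not> (u \<le> n \<and> v \<le> n) \<or> \<not> (v \<le> n \<and> u \<le> n)) \<longleftrightarrow> S = {..n}"
    for S
    by (cases "S = {}") (simp, blast)
  then show ?thesis
    unfolding SCCs_def pre_digraph.sccs_verts_def reachable_back_path_iff[OF assms] by simp
qed

lemma graph_diameter_back_path:
  assumes "0 < n"
  shows "graph_diameter (back_path n n) = n"
  unfolding graph_diameter_def reachable_back_path_iff[OF assms]
proof (rule Max_eqI)
  let ?G = "back_path n n"
  have le: "distance ?G u v \<le> n" if uv: "u \<le> n" "v \<le> n" for u v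
  proof -
    obtain p where "pre_digraph.awalk (with_proj ?G) u p v" "length p \<le> n"
      using awalk_back_path_short[OF uv assms] by blast
    then have "distance ?G u v \<le> length p"
      unfolding distance_def by (intro Least_le) blast
    with \<open>length p \<le> n\<close> show ?thesis by simp
  qed
  have "{distance ?G u v |u v. u \<le> n \<and> v \<le> n} = (\<lambda>(u, v). distance ?G u v) ` ({..n} \<times> {..n})"
    by auto
  then show "finite {distance ?G u v |u v. u \<le> n \<and> v \<le> n}" by simp
  show "d \<le> n" if "d \<in> {distance ?G u v |u v. u \<le> n \<and> v \<le> n}" for d
    using that le by auto
  have "distance ?G n 0 = n"
    unfolding distance_def
  proof (rule Least_equality)
    show "\<exists>p. pre_digraph.awalk (with_proj ?G) n p 0 \<and> length p = n"
      using awalk_back_path_descending[of 0 n n] by simp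
  qed (use awalk_back_path_length_ge in fastforce)
  then show "n \<in> {distance ?G u v |u v. u \<le> n \<and> v \<le> n}" by force
qed

lemma SCCs_back_path_missing:
  assumes "m < n"
  shows "SCCs (back_path n m) \<noteq> SCCs (back_path n n)"
proof
  interpret pair_fin_digraph "back_path n m" by (rule pair_fin_digraph_back_path)
  assume "SCCs (back_path n m) = SCCs (back_path n n)"
  with assms have "{..n} \<in> sccs_verts" by (simp add: SCCs_back_path flip: SCCs_def)
  then have "\<forall>u\<in>{..n}. \<forall>v\<in>{..n}. u \<rightarrow>\<^sup>*\<^bsub>with_proj (back_path n m)\<^esub> v"
    unfolding in_sccs_verts_conv_reachable by blast
  with assms have "Suc m \<rightarrow>\<^sup>*\<^bsub>with_proj (back_path n m)\<^esub> m" by simp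
  \<comment> \<open>Without the arc from \<open>Suc m\<close> to \<open>m\<close>, no arc leaves the
    set of vertices above \<open>m\<close>.\<close>
  moreover have "m < v" if "Suc m \<rightarrow>\<^sup>*\<^bsub>with_proj (back_path n m)\<^esub> v" for v
    using that by (induction rule: reachable_induct) (auto simp: parcs_back_path_iff)
  ultimately show False by blast
qed


section \<open>One operation inspects one backward arc\<close>

lemma Pre_back_path: "\<exists>q. \<forall>m. m \<noteq> q \<longrightarrow> Pre (back_path n m) S = Pre (back_path n n) S"
proof (cases "S \<inter> {..n} = {}")
  case True
  then show ?thesis by (fastforce simp: Pre_def parcs_back_path_iff)
next
  case False
  define M where "M = Max (S \<inter> {..n})"
  have "M \<in> S \<inter> {..n}" unfolding M_def using False by (intro Max_in) auto
  then have M: "M \<in> S" "M \<le> n" by auto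
  have max: "s \<le> M" if "s \<in> S" "s \<le> n" for s
    using that by (auto simp: M_def)
  have "Pre (back_path n m) S = Pre (back_path n n) S" if "m \<noteq> M" for m
  proof -
    \<comment> \<open>Vertices up to \<open>M\<close> reach \<open>M\<close> by a forward arc or
      self-loop. Any backward arc into \<open>S\<close> below \<open>M\<close> starts at a vertex
      \<open>\<le> M\<close>, so only \<open>Suc M\<close> can depend on \<open>l\<close>.\<close>
    have "v \<in> Pre (back_path n l) S \<longleftrightarrow> v \<le> n \<and> (v \<le> M \<or> v = Suc M \<and> M \<noteq> l)" for v l
    proof
      assume "v \<in> Pre (back_path n l) S"
      then obtain s where "s \<in> S" "s \<le> n" "v \<le> n" "v \<le> s \<or> v = Suc s \<and> s \<noteq> l"
        by (auto simp: Pre_def parcs_back_path_iff)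
      with max[of s] show "v \<le> n \<and> (v \<le> M \<or> v = Suc M \<and> M \<noteq> l)"
        by (cases "s = M") auto
    next
      assume "v \<le> n \<and> (v \<le> M \<or> v = Suc M \<and> M \<noteq> l)"
      with M show "v \<in> Pre (back_path n l) S"
        by (auto simp: Pre_def parcs_back_path_iff)
    qed
    with that show ?thesis by auto
  qed
  then show ?thesis by blast
qed

lemma Post_back_path: "\<exists>q. \<forall>m. m \<noteq> q \<longrightarrow> Post (back_path n m) S = Post (back_path n n) S"
proof (cases "S \<inter> {..n} = {}")
  case True
  then show ?thesis by (fastforce simp: Post_def parcs_back_path_iff)
next
  case False
  define M where "M = Min (S \<inter> {..n})"
  have "M \<in> S \<inter> {..n}" unfolding M_def using False by (intro Min_in) auto
  then have M: "M \<in> S" "M \<le> n" by auto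
  have min: "M \<le> s" if "s \<in> S" "s \<le> n" for s
    using that by (auto simp: M_def)
  \<comment> \<open>The arc leaving \<open>M\<close> backwards has index \<open>M - 1\<close>. For
    \<open>M = 0\<close> there is no such arc, and truncated subtraction merely excludes index 0 as
    well.\<close>
  have "Post (back_path n m) S = Post (back_path n n) S" if "m \<noteq> M - 1" for m
  proof -
    have "v \<in> Post (back_path n l) S \<longleftrightarrow> v \<le> n \<and> (M \<le> v \<or> M = Suc v \<and> v \<noteq> l)" for v l
    proof
      assume "v \<in> Post (back_path n l) S"
      then obtain s where "s \<in> S" "s \<le> n" "v \<le> n" "s \<le> v \<or> s = Suc v \<and> v \<noteq> l"
        by (auto simp: Post_def parcs_back_path_iff)
      with min[of s] show "v \<le> n \<and> (M \<le> v \<or> M = Suc v \<and> v \<noteq> l)"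
        by (cases "s = M") auto
    next
      assume "v \<le> n \<and> (M \<le> v \<or> M = Suc v \<and> v \<noteq> l)"
      with M show "v \<in> Post (back_path n l) S"
        by (auto simp: Post_def parcs_back_path_iff)
    qed
    with that M show ?thesis by auto
  qed
  then show ?thesis by blast
qed

text \<open>Adaptivity does no harm: for \<open>m\<close> outside \<open>Q\<close> the histories
  agree, so the next action is the same and adds at most one index to \<open>Q\<close>. The bound is
  the length of the history, not \<open>k\<close>, since steps after \<open>Output\<close> cost
  nothing.\<close>

lemma answers_back_path:
  "\<exists>Q. finite Q \<and> card Q \<le> length (answers (back_path n n) s k) \<and>
     (\<forall>m. m \<notin> Q \<longrightarrow> answers (back_path n m) s k = answers (back_path n n) s k)"
proof (induction k)
  case 0
  then show ?case by (intro exI[of _ "{}"]) auto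
next
  case (Suc k)
  then obtain Q where Q: "finite Q" "card Q \<le> length (answers (back_path n n) s k)"
    "\<And>m. m \<notin> Q \<Longrightarrow> answers (back_path n m) s k = answers (back_path n n) s k"
    by blast
  show ?case
  proof (cases "s (answers (back_path n n) s k)")
    case (PreOp S)
    obtain q where "\<And>m. m \<noteq> q \<Longrightarrow> Pre (back_path n m) S = Pre (back_path n n) S"
      using Pre_back_path by blast
    with Q PreOp show ?thesis
      by (intro exI[of _ "insert q Q"]) (auto simp: card_insert_if)
  next
    case (PostOp S)
    obtain q where "\<And>m. m \<noteq> q \<Longrightarrow> Post (back_path n m) S = Post (back_path n n) S"
      using Post_back_path by blast
    with Q PostOp show ?thesis
      by (intro exI[of _ "insert q Q"]) (auto simp: card_insert_if)
  next
    case (Output r)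
    with Q show ?thesis by (intro exI[of _ Q]) auto
  qed
qed


section \<open>Query complexity of the hard inputs\<close>

lemma answers_after_Output:
  assumes "s (answers G s k) = Output r" "k \<le> l"
  shows "answers G s l = answers G s k"
  using assms(2) by (induction l rule: dec_induct) (use assms(1) in auto)

lemma outputs_unique:
  assumes "outputs G s r" "outputs G s r'"
  shows "r = r'"
proof -
  obtain k l where k: "s (answers G s k) = Output r" and l: "s (answers G s l) = Output r'"
    using assms by (auto simp: outputs_def)
  have "answers G s k = answers G s l"
    using answers_after_Output[of s, OF k] answers_after_Output[of s, OF l] by (metis nat_le_linear)
  with k l show ?thesis by simp
qed

lemma card_distinguished_le_num_ops:
  assumes "outputs (back_path n n) s (SCCs (back_path n n))"
  shows "enat (card {m. m < n \<and> outputs (back_path n m) s (SCCs (back_path n m))})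
    \<le> num_ops (back_path n n) s"
proof -
  obtain k where k: "s (answers (back_path n n) s k) = Output (SCCs (back_path n n))"
    using assms by (auto simp: outputs_def)
  obtain Q where Q: "finite Q" "card Q \<le> length (answers (back_path n n) s k)"
    "\<And>m. m \<notin> Q \<Longrightarrow> answers (back_path n m) s k = answers (back_path n n) s k"
    using answers_back_path by blast
  \<comment> \<open>An arc outside \<open>Q\<close> could be removed without changing the output,
    which would then be wrong for the changed graph.\<close>
  have "{m. m < n \<and> outputs (back_path n m) s (SCCs (back_path n m))} \<subseteq> Q"
  proof (intro subsetI, rule ccontr)
    fix m assume m: "m \<in> {m. m < n \<and> outputs (back_path n m) s (SCCs (back_path n m))}"
      and "m \<notin> Q"
    with Q k have "outputs (back_path n m) s (SCCs (back_path n n))"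
      by (auto simp: outputs_def intro!: exI[of _ k])
    with m show False using outputs_unique SCCs_back_path_missing by fastforce
  qed
  with Q have "card {m. m < n \<and> outputs (back_path n m) s (SCCs (back_path n m))}
      \<le> length (answers (back_path n n) s k)"
    by (meson card_mono order_trans)
  also have "enat \<dots> \<le> num_ops (back_path n n) s"
    unfolding num_ops_def by (rule SUP_upper) simp
  finally show ?thesis by simp
qed

interpretation coin_tosses: prob_space coin_tosses
  unfolding coin_tosses_def by (intro prob_space_PiM prob_space_measure_pmf)

lemma (in prob_space) prob_Int_ge:
  assumes "A \<in> events" "B \<in> events"
  shows "prob A + prob B - 1 \<le> prob (A \<inter> B)"
proof -
  have "prob A - prob (A \<inter> B) = prob (A - B)"
    using assms by (simp add: finite_measure_Diff')
  also have "\<dots> \<le> prob (space M - B)"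
    using assms sets.sets_into_space[OF assms(1)] by (intro finite_measure_mono) auto
  finally show ?thesis using assms by (simp add: prob_compl)
qed

text \<open>Double counting: the sum is the expected number of events \<open>B i\<close> that
  occur.\<close>

lemma (in prob_space) sum_prob_le:
  assumes "finite I" "\<And>i. i \<in> I \<Longrightarrow> B i \<in> events"
    and "\<And>x. x \<in> space M \<Longrightarrow> card {i \<in> I. x \<in> B i} \<le> T"
  shows "(\<Sum>i\<in>I. prob (B i)) \<le> real T"
proof -
  have count: "(\<Sum>i\<in>I. indicator (B i) x) = real (card {i \<in> I. x \<in> B i})" for x
    using assms(1) by (simp add: indicator_def of_bool_def sum.If_cases Int_def)
  have "(\<Sum>i\<in>I. prob (B i)) = (\<Sum>i\<in>I. expectation (indicator (B i)))"
    using assms(2) by simp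
  also have "\<dots> = expectation (\<lambda>x. \<Sum>i\<in>I. indicator (B i) x)"
    using assms(2) by (subst Bochner_Integration.integral_sum) (auto simp: emeasure_eq_measure)
  also have "\<dots> \<le> expectation (\<lambda>x. real T)"
    using assms by (intro integral_mono Bochner_Integration.integrable_sum)
      (auto simp: count emeasure_eq_measure)
  finally show ?thesis by (simp add: prob_space)
qed

lemma prob_cost_back_path:
  assumes "prob_solves SCCs A"
  shows "ereal (real n / 3) \<le> ereal_of_enat (prob_cost A (back_path n n))"
proof (cases "prob_cost A (back_path n n)")
  case infinity
  then show ?thesis by simp
next
  case (enat T)
  define C where "C m = {b. outputs (back_path n m) (A {..n} b) (SCCs (back_path n m))}" for m
  have prob_C: "2 / 3 \<le> coin_tosses.prob (C m)" for m
    using assms pair_fin_digraph_back_path[of n m] by (force simp: prob_solves_def C_def)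
  \<comment> \<open>A non-measurable set has measure 0, which is below \<open>2 / 3\<close>.\<close>
  then have events: "C m \<in> coin_tosses.events" for m
    using prob_C[of m] measure_notin_sets[of "C m" coin_tosses]
    by (cases "C m \<in> coin_tosses.events") auto
  \<comment> \<open>If \<open>b\<close> is not in \<open>C n\<close>, the set is empty; otherwise
    the bound for a fixed strategy applies.\<close>
  have "card {m \<in> {..<n}. b \<in> C n \<inter> C m} \<le> T" for b
  proof (cases "b \<in> C n")
    case True
    then have "enat (card {m. m < n \<and> b \<in> C m}) \<le> num_ops (back_path n n) (A {..n} b)"
      using card_distinguished_le_num_ops by (simp add: C_def)
    also have "\<dots> \<le> prob_cost A (back_path n n)"
      unfolding prob_cost_def by (auto intro: SUP_upper)
    finally show ?thesis using True enat by simp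
  qed simp
  then have "(\<Sum>m<n. coin_tosses.prob (C n \<inter> C m)) \<le> real T"
    using events by (intro coin_tosses.sum_prob_le) auto
  moreover have "(\<Sum>m<n. 1 / 3) \<le> (\<Sum>m<n. coin_tosses.prob (C n \<inter> C m))"
  proof (rule sum_mono)
    fix m
    \<comment> \<open>Here \<open>1 / 3\<close> is \<open>2 / 3 + 2 / 3 - 1\<close>.\<close>
    show "1 / 3 \<le> coin_tosses.prob (C n \<inter> C m)"
      using coin_tosses.prob_Int_ge[OF events events, of n m] prob_C[of n] prob_C[of m]
      by linarith
  qed
  ultimately show ?thesis using enat by simp
qed

lemma det_solves_imp_prob_solves:
  assumes "det_solves f A"
  shows "prob_solves f (\<lambda>V b. A V)"
proof -
  have "space coin_tosses = UNIV" by (simp add: coin_tosses_def space_PiM)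
  then have "coin_tosses.prob UNIV = 1" using coin_tosses.prob_space by simp
  with assms show ?thesis by (simp add: det_solves_def prob_solves_def)
qed

text \<open>The slack factor 2 covers the vertex count \<open>n + 1\<close> as well as the product
  \<open>1 * n\<close>; it turns the bound \<open>n / 3\<close> into the constant
  \<open>1 / 6\<close>.\<close>

lemma needs_Omega_ops_SCCs:
  assumes ge: "\<And>n. 0 < n \<Longrightarrow> n \<le> g (back_path n n)"
    and le: "\<And>n. 0 < n \<Longrightarrow> g (back_path n n) \<le> 2 * n"
  shows "needs_Omega_ops SCCs g"
proof -
  have prob: "\<exists>G. pair_fin_digraph G \<and> N \<le> g G \<and>
      ereal (1 / 6 * real (g G)) \<le> ereal_of_enat (prob_cost A G)"
    if "prob_solves SCCs A" for A N
  proof (intro exI conjI)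
    \<comment> \<open>\<open>Suc N\<close> rather than \<open>N\<close> keeps the size positive when
      \<open>N = 0\<close>.\<close>
    let ?G = "back_path (Suc N) (Suc N)"
    show "N \<le> g ?G" using ge[of "Suc N"] by simp
    have "ereal (1 / 6 * real (g ?G)) \<le> ereal (real (Suc N) / 3)"
      using le[of "Suc N"] by (simp add: field_simps)
    also note prob_cost_back_path[OF that]
    finally show "ereal (1 / 6 * real (g ?G)) \<le> ereal_of_enat (prob_cost A ?G)" .
  qed (rule pair_fin_digraph_back_path)
  moreover have "\<exists>G. pair_fin_digraph G \<and> N \<le> g G \<and>
      ereal (1 / 6 * real (g G)) \<le> ereal_of_enat (det_cost A G)"
    if "det_solves SCCs A" for A N
    using prob[OF det_solves_imp_prob_solves[OF that], of N]
    by (simp add: prob_cost_def det_cost_def)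
  ultimately show ?thesis
    unfolding needs_Omega_ops_def by (intro exI[of _ "1 / 6"]) auto
qed

theorem theorem3p2:
  shows "needs_Omega_ops SCCs (\<lambda>G. card (pverts G)) \<and>
         needs_Omega_ops SCCs (\<lambda>G. card (SCCs G) * graph_diameter G)"
  by (intro conjI needs_Omega_ops_SCCs) (simp_all add: SCCs_back_path graph_diameter_back_path)

end
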